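(* For any graph $G$, $\mathrm{gd}(G)\ge \nu^=(G)$.
   Context: Graphs are finite, simple and undirected, with nonempty vertex set. For $G=(V=[n],E)$, the Gram dimension $\mathrm{gd}(G)$ is the smallest integer $k\ge 1$ such that for every real symmetric positive semidefinite $n\times n$ matrix $X$ there exists a positive semidefinite $n\times n$ matrix $X'$ of rank at most $k$ with $X'_{ii}=X_{ii}$ for all $i\in[n]$ and $X'_{ij}=X_{ij}$ for all $ij\in E$. Let $\mathcal C(G)$ be the set of real symmetric positive semidefinite $n\times n$ matrices $M$ with $M_{ij}=0$ for all distinct $i,j\in V$ with $(i,j)\notin E$. The parameter $\nu^=(G)$ is the maximum corank (dimension of the kernel) of a matrix $M\in\mathcal C(G)$ satisfying the strong Arnold property: for every real symmetric $n\times n$ matrix $X$, if $MX=0$, $X_{ii}=0$ for all $i\in V$ and $X_{ij}=0$ for all $(i,j)\in E$, then $X=0$. *)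

theory Defs
  imports "HOL-Analysis.Analysis"
begin

text \<open>A graph has the elements of a finite type as its vertices (types are nonempty) and is given by
  its adjacency relation, so that each edge occurs in both orientations.\<close>

definition simple_graph :: "('n::finite \<times> 'n) set \<Rightarrow> bool"
  where "simple_graph E \<longleftrightarrow> sym E \<and> irrefl E"

definition symmetric_matrix :: "real^'n^'n \<Rightarrow> bool"
  where "symmetric_matrix X \<longleftrightarrow> transpose X = X"

definition psd :: "real^'n^'n \<Rightarrow> bool"
  where "psd X \<longleftrightarrow> symmetric_matrix X \<and> (\<forall>x. 0 \<le> x \<bullet> (X *v x))"

definition gram_bound :: "('n::finite \<times> 'n) set \<Rightarrow> nat \<Rightarrow> bool"
  where "gram_bound E k \<longleftrightarrow>
    (\<forall>X :: real^'n^'n. psd X \<longrightarrow>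
      (\<exists>X' :: real^'n^'n. psd X' \<and> rank X' \<le> k \<and>
        (\<forall>i. X' $ i $ i = X $ i $ i) \<and>
        (\<forall>(i, j) \<in> E. X' $ i $ j = X $ i $ j)))"

definition gram_dimension :: "('n::finite \<times> 'n) set \<Rightarrow> nat"
  where "gram_dimension E = (LEAST k. 1 \<le> k \<and> gram_bound E k)"

definition graph_psd_matrices :: "('n::finite \<times> 'n) set \<Rightarrow> (real^'n^'n) set"
  where "graph_psd_matrices E =
    {M. psd M \<and> (\<forall>i j. i \<noteq> j \<longrightarrow> (i, j) \<notin> E \<longrightarrow> M $ i $ j = 0)}"

definition corank :: "real^'n^'n \<Rightarrow> nat"
  where "corank M = dim {x. M *v x = 0}"

definition strong_arnold :: "('n::finite \<times> 'n) set \<Rightarrow> real^'n^'n \<Rightarrow> bool"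
  where "strong_arnold E M \<longleftrightarrow>
    (\<forall>X :: real^'n^'n. symmetric_matrix X \<longrightarrow> M ** X = 0 \<longrightarrow>
      (\<forall>i. X $ i $ i = 0) \<longrightarrow> (\<forall>(i, j) \<in> E. X $ i $ j = 0) \<longrightarrow> X = 0)"

definition nu_eq :: "('n::finite \<times> 'n) set \<Rightarrow> nat"
  where "nu_eq E = Max (corank ` {M \<in> graph_psd_matrices E. strong_arnold E M})"

text \<open>The minimum and the maximum above are attained.\<close>

lemma gram_bound_card: "gram_bound (E :: ('n::finite \<times> 'n) set) CARD('n)"
  unfolding gram_bound_def
proof (intro allI impI)
  fix X :: "real^'n^'n"
  assume "psd X"
  moreover have "rank X \<le> CARD('n)"
    using rank_bound[of X] by simp
  ultimately show "\<exists>X' :: real^'n^'n. psd X' \<and> rank X' \<le> CARD('n) \<and>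
      (\<forall>i. X' $ i $ i = X $ i $ i) \<and> (\<forall>(i, j) \<in> E. X' $ i $ j = X $ i $ j)"
    by (intro exI[of _ X]) auto
qed

lemma gram_dimension_attained:
  "1 \<le> gram_dimension E" "gram_bound E (gram_dimension E)"
proof -
  have "1 \<le> gram_dimension E \<and> gram_bound E (gram_dimension E)"
    unfolding gram_dimension_def
    by (rule LeastI[where k = "CARD('a)"]) (simp add: gram_bound_card Suc_le_eq)
  then show "1 \<le> gram_dimension E" "gram_bound E (gram_dimension E)"
    by auto
qed

lemma finite_coranks: "finite (corank ` (S :: (real^'n^'n) set))"
proof (rule finite_subset)
  show "corank ` S \<subseteq> {.. CARD('n)}"
    using dim_subset_UNIV[where 'a = "real^'n"] by (auto simp: corank_def)
qed simp

lemma mat_1_strong_arnold: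
  "mat 1 \<in> {M \<in> graph_psd_matrices E. strong_arnold E M}"
proof -
  have off: "(mat 1 :: real^'a^'a) $ i $ j = 0" if "i \<noteq> j" for i j
    using that by (simp add: mat_def)
  have "psd (mat 1 :: real^'a^'a)"
    by (simp add: psd_def symmetric_matrix_def transpose_mat)
  with off show ?thesis
    by (simp add: graph_psd_matrices_def strong_arnold_def)
qed

lemma nu_eq_attained:
  "\<exists>M \<in> graph_psd_matrices E. strong_arnold E M \<and> corank M = nu_eq E"
proof -
  have "corank ` {M \<in> graph_psd_matrices E. strong_arnold E M} \<noteq> {}"
    using mat_1_strong_arnold[of E] by blast
  from Max_in[OF finite_coranks this] show ?thesis
    unfolding nu_eq_def by force
qed

end

theory Submission
  imports Defs
begin

text \<open>Let \<open>M\<close> attain \<open>\<nu>\<^sup>=\<close> and let \<open>P\<close> be the orthogonal projection onto the kernel of \<open>M\<close>. Any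
  positive semidefinite \<open>X\<close> that agrees with \<open>P\<close> on the diagonal and on the edges satisfies
  \<open>tr (M X) = tr (M P) = 0\<close>, hence \<open>M X = 0\<close>; the strong Arnold property applied to \<open>X - P\<close> gives
  \<open>X = P\<close>. Thus \<open>P\<close>, whose rank is the corank of \<open>M\<close>, is its own only completion.\<close>

section \<open>Quadratic forms of positive semidefinite matrices\<close>

lemma symmetric_matrix_nth:
  assumes "symmetric_matrix X"
  shows "X $ i $ j = X $ j $ i"
proof -
  have "transpose X $ j $ i = X $ j $ i"
    using assms by (simp add: symmetric_matrix_def)
  then show ?thesis by (simp add: transpose_def)
qed

lemma symmetric_matrix_diff:
  assumes "symmetric_matrix X" "symmetric_matrix Y"
  shows "symmetric_matrix (X - Y)"
proof -
  have "transpose (X - Y) = transpose X - transpose Y"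
    by (simp add: transpose_def vec_eq_iff)
  then show ?thesis using assms by (simp add: symmetric_matrix_def)
qed

lemma symmetric_matrix_inner:
  "symmetric_matrix X \<Longrightarrow> x \<bullet> (X *v y) = (X *v x) \<bullet> y"
  unfolding symmetric_matrix_def by (metis dot_lmul_matrix vector_transpose_matrix)

text \<open>Discriminant argument: the form at \<open>s *\<^sub>R x + t *\<^sub>R y\<close> is a
  nonnegative binary quadratic form in \<open>s\<close> and \<open>t\<close>. As \<open>X\<close>
  may be singular, \<open>c = 0\<close> is a case of its own.\<close>

lemma psd_Cauchy_Schwarz:
  assumes "psd X"
  shows "(x \<bullet> (X *v y))\<^sup>2 \<le> (x \<bullet> (X *v x)) * (y \<bullet> (X *v y))"
proof -
  define a b c where "a = x \<bullet> (X *v x)" and "b = x \<bullet> (X *v y)" and "c = y \<bullet> (X *v y)"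
  have "y \<bullet> (X *v x) = b"
    using assms unfolding psd_def b_def by (metis symmetric_matrix_inner inner_commute)
  then have q: "0 \<le> s\<^sup>2 * a + 2 * s * t * b + t\<^sup>2 * c" for s t
  proof -
    have "0 \<le> (s *\<^sub>R x + t *\<^sub>R y) \<bullet> (X *v (s *\<^sub>R x + t *\<^sub>R y))"
      using assms by (simp add: psd_def)
    also have "\<dots> = s\<^sup>2 * a + 2 * s * t * b + t\<^sup>2 * c"
      using \<open>y \<bullet> (X *v x) = b\<close>
      by (simp add: a_def b_def c_def power2_eq_square algebra_simps)
    finally show ?thesis .
  qed
  have "b\<^sup>2 \<le> a * c"
  proof (cases "c = 0")
    case True
    have "b = 0"
    proof (rule ccontr)
      assume "b \<noteq> 0"
      \<comment> \<open>With \<open>c = 0\<close> the form is linear in \<open>t\<close> at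
        \<open>s = 1\<close>; this \<open>t\<close> makes its value
        \<open>a - (a + 1) = -1\<close>.\<close>
      then show False
        using q[of 1 "- (a + 1) / (2 * b)"] True by (simp add: field_simps)
    qed
    then show ?thesis using True by simp
  next
    case False
    then have "c > 0" using assms by (simp add: psd_def c_def less_le)
    \<comment> \<open>For \<open>s = c\<close> the form is smallest at
      \<open>t = - b\<close>.\<close>
    moreover have "0 \<le> c * (a * c - b\<^sup>2)"
      using q[of c "- b"] by (simp add: power2_eq_square algebra_simps)
    ultimately show ?thesis by (simp add: zero_le_mult_iff)
  qed
  then show ?thesis by (simp add: a_def b_def c_def)
qed

text \<open>Cauchy-Schwarz with \<open>X *v v\<close> as first vector bounds the fourth power of its
  norm by 0.\<close>

lemma psd_quadratic_zero:
  assumes "psd X" "v \<bullet> (X *v v) = 0"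
  shows "X *v v = 0"
  using psd_Cauchy_Schwarz[OF assms(1), of "X *v v" v] assms(2) by simp

lemma axis_quadratic: "axis i 1 \<bullet> ((X :: real^'n^'n) *v axis j 1) = X $ i $ j"
  by (simp add: inner_axis' matrix_vector_mult_basis column_def)

text \<open>Cauchy-Schwarz on axis vectors bounds the square of each entry by a product of two
  diagonal entries. This is the base case of the elimination below.\<close>

lemma psd_zero_diagonal:
  assumes "psd X" "\<And>i. X $ i $ i = 0"
  shows "X = 0"
proof -
  have "X $ i $ j = 0" for i j
    using psd_Cauchy_Schwarz[OF assms(1), of "axis i 1" "axis j 1"] assms(2)
    by (simp add: axis_quadratic)
  then show ?thesis by (simp add: vec_eq_iff)
qed

section \<open>Decomposition into rank-one matrices\<close>

definition outer :: "real^'n \<Rightarrow> real^'n^'n"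
  where "outer v = (\<chi> i j. v $ i * v $ j)"

lemma outer_nth [simp]: "outer v $ i $ j = v $ i * v $ j"
  by (simp add: outer_def)

lemma outer_mult_vector: "outer v *v x = (v \<bullet> x) *\<^sub>R v"
  by (simp add: vec_eq_iff matrix_vector_mult_def inner_vec_def sum_distrib_left mult_ac)

lemma psd_outer: "psd (outer v)"
  by (simp add: psd_def symmetric_matrix_def transpose_def vec_eq_iff outer_mult_vector
      inner_commute mult.commute)

lemma psd_add: "psd X \<Longrightarrow> psd Y \<Longrightarrow> psd (X + Y)"
  by (simp add: psd_def symmetric_matrix_def transpose_def vec_eq_iff
      matrix_vector_mult_add_rdistrib inner_add_right)

lemma psd_sum: "(\<And>i. i \<in> S \<Longrightarrow> psd (f i)) \<Longrightarrow> psd (sum f S)"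
proof (induction S rule: infinite_finite_induct)
  case (insert x F)
  then show ?case by (simp add: psd_add)
qed (simp_all add: psd_def symmetric_matrix_def transpose_def vec_eq_iff)

text \<open>Symmetric Gaussian elimination: each step clears one row and column by a Schur complement. If
  the pivot is \<open>0\<close>, so is its row, and division by zero makes the subtracted term vanish.\<close>

lemma psd_sum_outer_supported:
  assumes "finite S" "psd M" "\<And>i. i \<notin> S \<Longrightarrow> M $ i $ i = 0"
  shows "\<exists>v. M = (\<Sum>i\<in>S. outer (v i))"
  using assms
proof (induction S arbitrary: M rule: finite_induct)
  case empty
  then show ?case using psd_zero_diagonal by auto
next
  case (insert k S)
  define w where "w = (1 / sqrt (M $ k $ k)) *\<^sub>R (M *v axis k 1)"
  define M' where "M' = M - outer w"
  have diag: "0 \<le> M $ i $ i" for i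
    using insert.prems(1) unfolding psd_def by (metis axis_quadratic)
  \<comment> \<open>The difference of the two sides is the quadratic form of \<open>M'\<close>, so
    this makes \<open>M'\<close> positive semidefinite. At \<open>x = axis i 1\<close> it also shows
    that \<open>w\<close> vanishes wherever the diagonal of \<open>M\<close> does, so that zero
    diagonal entries stay zero.\<close>
  have CS: "(x \<bullet> w)\<^sup>2 \<le> x \<bullet> (M *v x)" for x
  proof -
    have "(x \<bullet> (M *v axis k 1))\<^sup>2 \<le> (x \<bullet> (M *v x)) * M $ k $ k"
      using psd_Cauchy_Schwarz[OF insert.prems(1), of x "axis k 1"] by (simp add: axis_quadratic)
    moreover have "(x \<bullet> w)\<^sup>2 = (x \<bullet> (M *v axis k 1))\<^sup>2 / M $ k $ k"
      using diag[of k] by (simp add: w_def power_divide)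
    moreover have "0 \<le> x \<bullet> (M *v x)"
      using insert.prems(1) by (simp add: psd_def)
    ultimately show ?thesis
      using diag[of k] by (cases "M $ k $ k = 0") (auto simp: divide_le_eq)
  qed
  have psd': "psd M'"
    unfolding psd_def
  proof
    show "symmetric_matrix M'"
      using insert.prems(1) psd_outer[of w] by (simp add: psd_def M'_def symmetric_matrix_diff)
    show "\<forall>x. 0 \<le> x \<bullet> (M' *v x)"
      using CS by (simp add: M'_def matrix_vector_mult_diff_rdistrib inner_diff_right
          outer_mult_vector power2_eq_square inner_commute)
  qed
  have "M' $ i $ i = 0" if "i \<notin> S" for i
  proof (cases "i = k")
    case True
    then show ?thesis
      using diag[of k] by (simp add: M'_def w_def matrix_vector_mult_basis column_def field_simps)
  next
    case False
    then have "M $ i $ i = 0" using insert.prems(2) that by simp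
    moreover have "(w $ i)\<^sup>2 \<le> M $ i $ i"
      using CS[of "axis i 1"] unfolding axis_quadratic by (simp add: inner_axis')
    ultimately show ?thesis by (simp add: M'_def)
  qed
  from insert.IH[OF psd' this] obtain v where v: "M' = (\<Sum>i\<in>S. outer (v i))" by blast
  have "M = (\<Sum>i\<in>insert k S. outer ((v(k := w)) i))"
  proof -
    have "(\<Sum>i\<in>S. outer ((v(k := w)) i)) = M'"
      unfolding v using insert.hyps(2) by (intro sum.cong) auto
    then show ?thesis using insert.hyps by (simp add: M'_def)
  qed
  then show ?case by blast
qed

lemma psd_sum_outer:
  fixes M :: "real^'n^'n"
  assumes "psd M"
  obtains v :: "'n \<Rightarrow> real^'n" where "M = (\<Sum>i\<in>UNIV. outer (v i))"
  using psd_sum_outer_supported[of UNIV M] assms by auto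

section \<open>Trace orthogonality and the kernel\<close>

text \<open>With \<open>M\<close> a sum of matrices \<open>outer (v k)\<close>, the double sum
  becomes the sum of the nonnegative terms \<open>v k \<bullet> (X *v v k)\<close>. All of them are
  0, hence \<open>X\<close> kills every \<open>v k\<close>, and by symmetry of \<open>X\<close> so
  does multiplication from the left.\<close>

lemma psd_trace_zero_imp_mult_zero:
  fixes M X :: "real^'n^'n"
  assumes "psd M" "psd X" and tr: "(\<Sum>i\<in>UNIV. \<Sum>j\<in>UNIV. M $ i $ j * X $ i $ j) = 0"
  shows "M ** X = 0"
proof -
  obtain v :: "'n \<Rightarrow> real^'n" where v: "M = (\<Sum>k\<in>UNIV. outer (v k))"
    using psd_sum_outer[OF assms(1)] .
  have "(\<Sum>k\<in>UNIV. v k \<bullet> (X *v v k)) =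
      (\<Sum>k\<in>UNIV. \<Sum>i\<in>UNIV. \<Sum>j\<in>UNIV. outer (v k) $ i $ j * X $ i $ j)"
    by (simp add: inner_vec_def matrix_vector_mult_def sum_distrib_left mult_ac)
  also have "\<dots> = (\<Sum>i\<in>UNIV. \<Sum>k\<in>UNIV. \<Sum>j\<in>UNIV. outer (v k) $ i $ j * X $ i $ j)"
    by (rule sum.swap)
  also have "\<dots> = (\<Sum>i\<in>UNIV. \<Sum>j\<in>UNIV. \<Sum>k\<in>UNIV. outer (v k) $ i $ j * X $ i $ j)"
    by (intro sum.cong refl sum.swap)
  also have "\<dots> = 0"
    using tr by (simp add: v sum_distrib_right)
  finally have "\<forall>k. v k \<bullet> (X *v v k) = 0"
    using assms(2) by (simp add: sum_nonneg_eq_0_iff psd_def)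
  then have "X *v v k = 0" for k
    using psd_quadratic_zero[OF assms(2)] by blast
  then have *: "(\<Sum>j\<in>UNIV. v k $ j * X $ j $ l) = 0" for k l
  proof -
    have "X $ j $ l = X $ l $ j" for j
      using assms(2) by (simp add: psd_def symmetric_matrix_nth)
    then have "(\<Sum>j\<in>UNIV. v k $ j * X $ j $ l) = (X *v v k) $ l"
      by (simp add: matrix_vector_mult_def mult.commute)
    then show ?thesis using \<open>X *v v k = 0\<close> by simp
  qed
  have "(M ** X) $ i $ l = 0" for i l
  proof -
    have "(M ** X) $ i $ l = (\<Sum>j\<in>UNIV. \<Sum>k\<in>UNIV. v k $ i * (v k $ j * X $ j $ l))"
      by (simp add: matrix_matrix_mult_def v sum_distrib_right mult.assoc)
    also have "\<dots> = (\<Sum>k\<in>UNIV. v k $ i * (\<Sum>j\<in>UNIV. v k $ j * X $ j $ l))"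
      by (subst sum.swap) (simp add: sum_distrib_left)
    finally show ?thesis by (simp add: *)
  qed
  then show ?thesis by (simp add: vec_eq_iff)
qed

text \<open>\<open>P\<close> is the sum of \<open>outer b\<close> over an orthonormal basis
  \<open>B\<close> of the kernel. It maps into the kernel and fixes each \<open>b\<close>, so its
  range contains the independent set \<open>B\<close>.\<close>

lemma kernel_projection:
  fixes M :: "real^'n^'n"
  obtains P :: "real^'n^'n" where "psd P" "M ** P = 0" "corank M \<le> rank P"
proof -
  have "subspace {x. M *v x = 0}"
    by (simp add: subspace_def matrix_vector_right_distrib matrix_vector_mult_scaleR)
  then obtain B where B:
    "B \<subseteq> {x. M *v x = 0}" "pairwise orthogonal B"
    "\<And>x. x \<in> B \<Longrightarrow> norm x = 1" "independent B" "card B = dim {x. M *v x = 0}"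
    by (rule orthonormal_basis_subspace) (rule that)
  have fin: "finite B" using B(4) by (rule independent_imp_finite)
  define P where "P = (\<Sum>b\<in>B. outer b)"
  have P: "P *v x = (\<Sum>b\<in>B. (b \<bullet> x) *\<^sub>R b)" for x
  proof -
    have "P *v x = (\<Sum>b\<in>B. outer b *v x)"
      unfolding P_def using fin
      by (induction B rule: finite_induct) (simp_all add: matrix_vector_mult_add_rdistrib)
    then show ?thesis by (simp add: outer_mult_vector)
  qed
  have "psd P"
    unfolding P_def by (intro psd_sum psd_outer)
  moreover have "M ** P = 0"
  proof -
    have "(M ** P) *v x = 0" for x
    proof -
      have "(M ** P) *v x = M *v (\<Sum>b\<in>B. (b \<bullet> x) *\<^sub>R b)"
        by (simp add: P flip: matrix_vector_mul_assoc)
      also have "\<dots> = (\<Sum>b\<in>B. (b \<bullet> x) *\<^sub>R (M *v b))"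
        by (simp add: linear_sum[OF matrix_vector_mul_linear] matrix_vector_mult_scaleR)
      also have "\<dots> = 0" using B(1) by (intro sum.neutral) auto
      finally show ?thesis .
    qed
    then show ?thesis by (simp add: matrix_eq)
  qed
  moreover have "corank M \<le> rank P"
  proof -
    have "P *v b = b" if "b \<in> B" for b
    proof -
      have "P *v b = (\<Sum>c\<in>B. if c = b then b else 0)"
        unfolding P using B(2,3) that
        by (intro sum.cong refl) (auto simp: pairwise_def orthogonal_def norm_eq_1)
      then show ?thesis using fin that by simp
    qed
    then have "B \<subseteq> range ((*v) P)" by (metis rangeI subsetI)
    then have "card B \<le> dim (range ((*v) P))"
      using B(4) by (rule independent_card_le_dim)
    then show ?thesis using B(5) by (simp add: corank_def rank_dim_range)
  qed
  ultimately show ?thesis using that by blast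
qed

section \<open>Uniqueness of the completion and the inequality\<close>

lemma psd_completion_unique:
  assumes M: "M \<in> graph_psd_matrices E" and arnold: "strong_arnold E M"
    and P: "psd P" "M ** P = 0" and X: "psd X"
    and diag: "\<And>i. X $ i $ i = P $ i $ i"
    and edges: "\<And>i j. (i, j) \<in> E \<Longrightarrow> X $ i $ j = P $ i $ j"
  shows "X = P"
proof -
  \<comment> \<open>On the diagonal and on edges \<open>X\<close> agrees with \<open>P\<close>;
    elsewhere \<open>M\<close> vanishes. The indices of \<open>P\<close> are transposed so that the
    sum over \<open>j\<close> is a diagonal entry of \<open>M ** P\<close>.\<close>
  have "M $ i $ j * X $ i $ j = M $ i $ j * P $ j $ i" for i j
  proof -
    have "M $ i $ j = 0 \<or> X $ i $ j = P $ i $ j"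
      using M diag edges unfolding graph_psd_matrices_def
      by (cases "i = j"; cases "(i, j) \<in> E") auto
    moreover have "P $ i $ j = P $ j $ i"
      using P(1) by (simp add: psd_def symmetric_matrix_nth)
    ultimately show ?thesis by auto
  qed
  then have "(\<Sum>i\<in>UNIV. \<Sum>j\<in>UNIV. M $ i $ j * X $ i $ j) = (\<Sum>i\<in>UNIV. (M ** P) $ i $ i)"
    by (simp only: matrix_matrix_mult_def vec_lambda_beta)
  then have "M ** X = 0"
    using M X P(2) by (intro psd_trace_zero_imp_mult_zero) (auto simp: graph_psd_matrices_def)
  then have "M ** (X - P) = 0"
    using P(2) by (simp add: matrix_matrix_mult_def vec_eq_iff right_diff_distrib sum_subtractf)
  moreover have "symmetric_matrix (X - P)"
    using X P(1) by (simp add: psd_def symmetric_matrix_diff)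
  ultimately have "X - P = 0"
    using arnold diag edges unfolding strong_arnold_def by auto
  then show ?thesis by simp
qed

theorem theorem8:
  fixes E :: "('n::finite \<times> 'n) set"
  assumes "simple_graph E"
  shows "gram_dimension E \<ge> nu_eq E"
proof -
  obtain M where M: "M \<in> graph_psd_matrices E" "strong_arnold E M" "corank M = nu_eq E"
    using nu_eq_attained by blast
  obtain P where P: "psd P" "M ** P = 0" "corank M \<le> rank P"
    using kernel_projection .
  obtain X where X: "psd X" "rank X \<le> gram_dimension E" "\<forall>i. X $ i $ i = P $ i $ i"
    "\<forall>(i, j) \<in> E. X $ i $ j = P $ i $ j"
    using gram_dimension_attained(2)[of E] P(1) unfolding gram_bound_def by blast
  \<comment> \<open>The low-rank completion is \<open>P\<close> itself, so the Gram dimension bounds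
    \<open>rank P\<close> and with it the corank of \<open>M\<close>.\<close>
  have "X = P"
    using psd_completion_unique[OF M(1,2) P(1,2) X(1)] X(3,4) by auto
  then show ?thesis using X(2) P(3) M(3) by simp
qed

end
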